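(* For any set $\Gamma$ of formulas of intuitionistic propositional logic and any formula $\varphi$, $$\Gamma\vdash\varphi \quad\text{if and only if}\quad \Gamma\vDash_{alg}\varphi,$$ where $\Gamma\vdash\varphi$ is derivability from $\Gamma$ in the Hilbert-style proof system described in the context and $\Gamma\vDash_{alg}\varphi$ is algebraic semantic consequence over Heyting algebras.
   Context: Formulas: built from a countable set of propositional variables indexed by natural numbers ($Var=\{p_n : n\in\mathbb{N}\}$) and $\bot$ by the binary connectives $\wedge,\vee,\to$ ($\wedge,\vee$ bind more strongly than $\to$, which associates to the right). Proof system: for a set $\Gamma$ of formulas, $\Gamma\vdash\varphi$ is defined inductively. Base cases: $\Gamma\vdash\varphi$ for $\varphi\in\Gamma$; and for all formulas $\varphi,\psi$ the axioms $\varphi\vee\varphi\to\varphi$; $\varphi\to\varphi\wedge\varphi$; $\varphi\to\varphi\vee\psi$; $\varphi\wedge\psi\to\varphi$; $\varphi\vee\psi\to\psi\vee\varphi$; $\varphi\wedge\psi\to\psi\wedge\varphi$; $\bot\to\varphi$. Rules (for all $\varphi,\psi,\chi$): from $\Gamma\vdash\varphi$ and $\Gamma\vdash\varphi\to\psi$ infer $\Gamma\vdash\psi$; from $\Gamma\vdash\varphi\to\psi$ and $\Gamma\vdash\psi\to\chi$ infer $\Gamma\vdash\varphi\to\chi$; from $\Gamma\vdash\varphi\wedge\psi\to\chi$ infer $\Gamma\vdash\varphi\to(\psi\to\chi)$; from $\Gamma\vdash\varphi\to(\psi\to\chi)$ infer $\Gamma\vdash\varphi\wedge\psi\to\chi$;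 from $\Gamma\vdash\varphi\to\psi$ infer $\Gamma\vdash\chi\vee\varphi\to\chi\vee\psi$. Algebraic semantics: a Heyting algebra $H$ is a bounded lattice (least element $0$, greatest element $1$) with an operation $\to$ such that $a\le b\to c$ iff $a\wedge b\le c$. An algebraic interpretation in $H$ is a function $I$ from formulas to $H$ with $I(\bot)=0$, $I(\varphi\wedge\psi)=I(\varphi)\wedge I(\psi)$, $I(\varphi\vee\psi)=I(\varphi)\vee I(\psi)$, $I(\varphi\to\psi)=I(\varphi)\to I(\psi)$ for all formulas $\varphi,\psi$ (thus it is determined by its arbitrary values on variables). An algebraic model is a pair $(H,I)$. A formula $\varphi$ is true in $(H,I)$ if $I(\varphi)=1$; a set $\Gamma$ is true in $(H,I)$ if all its members are. $\Gamma\vDash_{alg}\varphi$ means: for every algebraic model $(H,I)$, if $\Gamma$ is true in $(H,I)$ then $\varphi$ is true in $(H,I)$. *)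

theory Defs
  imports "HOL-Algebra.Lattice"
begin

datatype form =
    Var nat
  | Bot  (\<open>\<^bold>\<bottom>\<close>)
  | And form form  (infixl \<open>\<^bold>\<and>\<close> 65)
  | Or form form  (infixl \<open>\<^bold>\<or>\<close> 65)
  | Imp form form  (infixr \<open>\<^bold>\<rightarrow>\<close> 60)

inductive derives :: "form set \<Rightarrow> form \<Rightarrow> bool"  (infix \<open>\<turnstile>\<close> 50)
  for \<Gamma> :: "form set"
where
  hyp: "\<phi> \<in> \<Gamma> \<Longrightarrow> \<Gamma> \<turnstile> \<phi>"
| or_contr: "\<Gamma> \<turnstile> (\<phi> \<^bold>\<or> \<phi>) \<^bold>\<rightarrow> \<phi>"
| and_contr: "\<Gamma> \<turnstile> \<phi> \<^bold>\<rightarrow> (\<phi> \<^bold>\<and> \<phi>)"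
| or_weak: "\<Gamma> \<turnstile> \<phi> \<^bold>\<rightarrow> (\<phi> \<^bold>\<or> \<psi>)"
| and_weak: "\<Gamma> \<turnstile> (\<phi> \<^bold>\<and> \<psi>) \<^bold>\<rightarrow> \<phi>"
| or_perm: "\<Gamma> \<turnstile> (\<phi> \<^bold>\<or> \<psi>) \<^bold>\<rightarrow> (\<psi> \<^bold>\<or> \<phi>)"
| and_perm: "\<Gamma> \<turnstile> (\<phi> \<^bold>\<and> \<psi>) \<^bold>\<rightarrow> (\<psi> \<^bold>\<and> \<phi>)"
| ex_falso: "\<Gamma> \<turnstile> \<^bold>\<bottom> \<^bold>\<rightarrow> \<phi>"
| mp: "\<Gamma> \<turnstile> \<phi> \<Longrightarrow> \<Gamma> \<turnstile> \<phi> \<^bold>\<rightarrow> \<psi> \<Longrightarrow> \<Gamma> \<turnstile> \<psi>"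
| syll: "\<Gamma> \<turnstile> \<phi> \<^bold>\<rightarrow> \<psi> \<Longrightarrow> \<Gamma> \<turnstile> \<psi> \<^bold>\<rightarrow> \<chi> \<Longrightarrow> \<Gamma> \<turnstile> \<phi> \<^bold>\<rightarrow> \<chi>"
| export: "\<Gamma> \<turnstile> (\<phi> \<^bold>\<and> \<psi>) \<^bold>\<rightarrow> \<chi> \<Longrightarrow> \<Gamma> \<turnstile> \<phi> \<^bold>\<rightarrow> (\<psi> \<^bold>\<rightarrow> \<chi>)"
| import: "\<Gamma> \<turnstile> \<phi> \<^bold>\<rightarrow> (\<psi> \<^bold>\<rightarrow> \<chi>) \<Longrightarrow> \<Gamma> \<turnstile> (\<phi> \<^bold>\<and> \<psi>) \<^bold>\<rightarrow> \<chi>"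
| or_mono: "\<Gamma> \<turnstile> \<phi> \<^bold>\<rightarrow> \<psi> \<Longrightarrow> \<Gamma> \<turnstile> (\<chi> \<^bold>\<or> \<phi>) \<^bold>\<rightarrow> (\<chi> \<^bold>\<or> \<psi>)"

record 'a heyting = "'a gorder" +
  himp :: "'a \<Rightarrow> 'a \<Rightarrow> 'a"  (infixr \<open>\<leadsto>\<index>\<close> 60)

locale heyting_algebra = bounded_lattice H for H (structure) +
  assumes himp_closed: "a \<in> carrier H \<Longrightarrow> b \<in> carrier H \<Longrightarrow> a \<leadsto> b \<in> carrier H"
    and residuation:
      "a \<in> carrier H \<Longrightarrow> b \<in> carrier H \<Longrightarrow> c \<in> carrier H \<Longrightarrow>
        a \<sqsubseteq> b \<leadsto> c \<longleftrightarrow> a \<sqinter> b \<sqsubseteq> c"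

definition alg_interpretation :: "'h heyting \<Rightarrow> (form \<Rightarrow> 'h) \<Rightarrow> bool" where
  "alg_interpretation H I \<longleftrightarrow>
    (\<forall>\<phi>. I \<phi> \<in> carrier H) \<and>
    I \<^bold>\<bottom> = \<bottom>\<^bsub>H\<^esub> \<and>
    (\<forall>\<phi> \<psi>. I (\<phi> \<^bold>\<and> \<psi>) = I \<phi> \<sqinter>\<^bsub>H\<^esub> I \<psi>) \<and>
    (\<forall>\<phi> \<psi>. I (\<phi> \<^bold>\<or> \<psi>) = I \<phi> \<squnion>\<^bsub>H\<^esub> I \<psi>) \<and>
    (\<forall>\<phi> \<psi>. I (\<phi> \<^bold>\<rightarrow> \<psi>) = I \<phi> \<leadsto>\<^bsub>H\<^esub> I \<psi>)"

definition alg_model :: "'h heyting \<Rightarrow> (form \<Rightarrow> 'h) \<Rightarrow> bool" where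
  "alg_model H I \<longleftrightarrow> heyting_algebra H \<and> alg_interpretation H I"

definition alg_true :: "'h heyting \<Rightarrow> (form \<Rightarrow> 'h) \<Rightarrow> form \<Rightarrow> bool" where
  "alg_true H I \<phi> \<longleftrightarrow> I \<phi> = \<top>\<^bsub>H\<^esub>"

text \<open>
  HOL cannot quantify over types inside a formula, so consequence over all Heyting algebras is
  indexed by a type \<open>'h\<close>: the models are all Heyting algebras whose carrier is a subset of
  \<open>'h\<close>. For infinite \<open>'h\<close> this includes, up to isomorphism, every countable
  Heyting algebra, in particular every Lindenbaum algebra of this language. For finite \<open>'h\<close>
  the relation can hold more often than consequence over all Heyting algebras (if \<open>'h\<close> has
  one element, every formula is a consequence of every set).
\<close>

definition alg_entails :: "'h itself \<Rightarrow> form set \<Rightarrow> form \<Rightarrow> bool" where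
  "alg_entails _ \<Gamma> \<phi> \<longleftrightarrow>
    (\<forall>(H :: 'h heyting) I. alg_model H I \<longrightarrow>
      (\<forall>\<psi>\<in>\<Gamma>. alg_true H I \<psi>) \<longrightarrow> alg_true H I \<phi>)"

end

(* Completeness: in the Lindenbaum algebra of \<Gamma>, formulas modulo provable equivalence, the
   derivable formulas form the top class. The language is countable, so this algebra can be copied
   into any infinite type. *)

theory Submission
  imports Defs "HOL-Library.Countable"
begin

section \<open>Soundness in Heyting algebras\<close>

context heyting_algebra
begin

text \<open>Residuation with \<top> on the left, where \<top> \<sqinter> a = a. It turns truth of an
  implication into an inequality between values.\<close>

lemma himp_eq_top_iff:
  assumes "a \<in> carrier H" "b \<in> carrier H"
  shows "a \<leadsto> b = \<top> \<longleftrightarrow> a \<sqsubseteq> b"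
proof -
  have "\<top> \<sqsubseteq> a \<leadsto> b \<longleftrightarrow> \<top> \<sqinter> a \<sqsubseteq> b"
    using assms residuation top_closed by blast
  moreover have "\<top> \<sqinter> a = a"
    using top_meet[OF assms(1)] by (simp add: eq_is_equal)
  moreover have "\<top> \<sqsubseteq> a \<leadsto> b \<longleftrightarrow> a \<leadsto> b = \<top>"
    using assms himp_closed le_antisym le_refl top_closed top_higher by metis
  ultimately show ?thesis by simp
qed

end

text \<open>Induction on the derivation. Through \<open>himp_eq_top_iff\<close> the axioms become
  lattice inequalities, \<open>syll\<close> becomes transitivity, and \<open>export\<close> and
  \<open>import\<close> become the two directions of \<open>residuation\<close>.\<close>

lemma soundness:
  fixes H (structure)
  assumes "alg_model H I"
    and \<Gamma>: "\<forall>\<psi>\<in>\<Gamma>. alg_true H I \<psi>"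
    and "\<Gamma> \<turnstile> \<phi>"
  shows "alg_true H I \<phi>"
proof -
  have "heyting_algebra H" and I: "alg_interpretation H I"
    using assms(1) by (simp_all add: alg_model_def)
  then interpret heyting_algebra H by simp
  have cl [simp]: "I \<psi> \<in> carrier H" for \<psi>
    using I by (simp add: alg_interpretation_def)
  have [simp]: "I \<^bold>\<bottom> = \<bottom>"
      "I (\<psi> \<^bold>\<and> \<chi>) = I \<psi> \<sqinter> I \<chi>"
      "I (\<psi> \<^bold>\<or> \<chi>) = I \<psi> \<squnion> I \<chi>"
    and I_imp [simp]: "I (\<psi> \<^bold>\<rightarrow> \<chi>) = I \<psi> \<leadsto> I \<chi>" for \<psi> \<chi>
    using I by (simp_all add: alg_interpretation_def)
  note [simp] = himp_eq_top_iff himp_closed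
  from \<open>\<Gamma> \<turnstile> \<phi>\<close> have "I \<phi> = \<top>"
  proof induction
    case (hyp \<psi>)
    then show ?case using \<Gamma> by (simp add: alg_true_def)
  next
    case (mp \<psi> \<chi>)
    then have "\<top> \<sqsubseteq> I \<chi>" by (metis cl I_imp himp_eq_top_iff)
    then show ?case by (intro le_antisym) (auto intro: top_higher)
  next
    case (syll \<psi> \<chi> \<theta>)
    then show ?case by (auto intro: le_trans[of _ "I \<chi>"])
  next
    case (or_mono \<psi> \<chi> \<theta>)
    then have "I \<psi> \<sqsubseteq> I \<theta> \<squnion> I \<chi>"
      by (auto intro: le_trans[OF _ join_right])
    then show ?case by (simp add: join_le join_left)
  qed (auto simp: residuation join_comm meet_comm
        intro: join_le meet_le join_left meet_left bottom_lower)
  then show ?thesis by (simp add: alg_true_def)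
qed

section \<open>Derived rules of the calculus\<close>

lemma imp_refl: "\<Gamma> \<turnstile> \<phi> \<^bold>\<rightarrow> \<phi>"
  by (rule syll[OF and_contr and_weak])

lemma and_weak_right: "\<Gamma> \<turnstile> (\<phi> \<^bold>\<and> \<psi>) \<^bold>\<rightarrow> \<psi>"
  by (rule syll[OF and_perm and_weak])

lemma or_weak_right: "\<Gamma> \<turnstile> \<psi> \<^bold>\<rightarrow> (\<phi> \<^bold>\<or> \<psi>)"
  by (rule syll[OF or_weak or_perm])

text \<open>Exporting the identity on \<psi> \<and> \<chi> gives \<psi> \<rightarrow> (\<chi>
  \<rightarrow> \<psi> \<and> \<chi>); precompose with the assumption and import again.\<close>

lemma and_mono_left:
  assumes "\<Gamma> \<turnstile> \<phi> \<^bold>\<rightarrow> \<psi>"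
  shows "\<Gamma> \<turnstile> (\<phi> \<^bold>\<and> \<chi>) \<^bold>\<rightarrow> (\<psi> \<^bold>\<and> \<chi>)"
  by (rule derives.import[OF syll[OF assms export[OF imp_refl]]])

text \<open>Duplicate \<chi> to \<chi> \<and> \<chi>, then replace one conjunct at a time, swapping
  the two in between.\<close>

lemma imp_and:
  assumes "\<Gamma> \<turnstile> \<chi> \<^bold>\<rightarrow> \<phi>" "\<Gamma> \<turnstile> \<chi> \<^bold>\<rightarrow> \<psi>"
  shows "\<Gamma> \<turnstile> \<chi> \<^bold>\<rightarrow> (\<phi> \<^bold>\<and> \<psi>)"
proof -
  have "\<Gamma> \<turnstile> \<chi> \<^bold>\<rightarrow> (\<chi> \<^bold>\<and> \<phi>)"
    using and_contr and_mono_left[OF assms(1)] and_perm by (blast intro: syll)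
  then show ?thesis
    using and_mono_left[OF assms(2)] and_perm by (blast intro: syll)
qed

text \<open>Dual to \<open>imp_and\<close>: both disjuncts are replaced by \<chi> in turn, and
  \<chi> \<or> \<chi> is contracted.\<close>

lemma or_imp:
  assumes "\<Gamma> \<turnstile> \<phi> \<^bold>\<rightarrow> \<chi>" "\<Gamma> \<turnstile> \<psi> \<^bold>\<rightarrow> \<chi>"
  shows "\<Gamma> \<turnstile> (\<phi> \<^bold>\<or> \<psi>) \<^bold>\<rightarrow> \<chi>"
proof -
  have "\<Gamma> \<turnstile> (\<phi> \<^bold>\<or> \<psi>) \<^bold>\<rightarrow> (\<chi> \<^bold>\<or> \<phi>)"
    by (rule syll[OF or_mono[OF assms(2)] or_perm])
  moreover have "\<Gamma> \<turnstile> (\<chi> \<^bold>\<or> \<phi>) \<^bold>\<rightarrow> \<chi>"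
    by (rule syll[OF or_mono[OF assms(1)] or_contr])
  ultimately show ?thesis by (rule syll)
qed

text \<open>This is what will make the class of a derivable formula the greatest element.\<close>

lemma imp_weaken:
  assumes "\<Gamma> \<turnstile> \<phi>"
  shows "\<Gamma> \<turnstile> \<psi> \<^bold>\<rightarrow> \<phi>"
  by (rule mp[OF assms export[OF and_weak]])

text \<open>Needed for implication to be well defined on classes. After \<open>export\<close>, the
  inner step is modus ponens in internal form, the import of the identity on \<phi> \<rightarrow>
  \<psi>.\<close>

lemma imp_mono:
  assumes "\<Gamma> \<turnstile> \<phi>' \<^bold>\<rightarrow> \<phi>" "\<Gamma> \<turnstile> \<psi> \<^bold>\<rightarrow> \<psi>'"
  shows "\<Gamma> \<turnstile> (\<phi> \<^bold>\<rightarrow> \<psi>) \<^bold>\<rightarrow> (\<phi>' \<^bold>\<rightarrow> \<psi>')"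
proof (rule export)
  have "\<Gamma> \<turnstile> ((\<phi> \<^bold>\<rightarrow> \<psi>) \<^bold>\<and> \<phi>') \<^bold>\<rightarrow> ((\<phi> \<^bold>\<rightarrow> \<psi>) \<^bold>\<and> \<phi>)"
    by (rule imp_and[OF and_weak syll[OF and_weak_right assms(1)]])
  moreover have "\<Gamma> \<turnstile> ((\<phi> \<^bold>\<rightarrow> \<psi>) \<^bold>\<and> \<phi>) \<^bold>\<rightarrow> \<psi>"
    by (rule derives.import[OF imp_refl])
  ultimately show "\<Gamma> \<turnstile> ((\<phi> \<^bold>\<rightarrow> \<psi>) \<^bold>\<and> \<phi>') \<^bold>\<rightarrow> \<psi>'"
    using assms(2) by (blast intro: syll)
qed

section \<open>The Lindenbaum algebra\<close>

instance form :: countable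
  by countable_datatype

text \<open>The quotient is given by a map whose kernel is provable equivalence. Its target type is
  left open, since \<open>alg_entails\<close> only sees algebras inside a prescribed type.\<close>

locale lindenbaum =
  fixes \<Gamma> :: "form set" and cls :: "form \<Rightarrow> 'h"
  assumes cls_eq_iff: "cls \<phi> = cls \<psi> \<longleftrightarrow> \<Gamma> \<turnstile> \<phi> \<^bold>\<rightarrow> \<psi> \<and> \<Gamma> \<turnstile> \<psi> \<^bold>\<rightarrow> \<phi>"
begin

text \<open>Order and implication are computed on representatives picked by \<open>inv cls\<close>.
  Meet, join and bounds are determined by the order, hence no fields for them.\<close>

definition alg :: "'h heyting" where
  "alg = \<lparr>carrier = range cls, eq = (=), le = (\<lambda>a b. \<Gamma> \<turnstile> inv cls a \<^bold>\<rightarrow> inv cls b),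
          himp = (\<lambda>a b. cls (inv cls a \<^bold>\<rightarrow> inv cls b))\<rparr>"

lemma carrier_alg: "carrier alg = range cls"
  by (simp add: alg_def)

lemma eq_alg: "(.=\<^bsub>alg\<^esub>) = (=)"
  by (simp add: alg_def)

lemma inv_cls_equiv: "\<Gamma> \<turnstile> inv cls (cls \<phi>) \<^bold>\<rightarrow> \<phi>" "\<Gamma> \<turnstile> \<phi> \<^bold>\<rightarrow> inv cls (cls \<phi>)"
  using cls_eq_iff[of "inv cls (cls \<phi>)" \<phi>] by (simp_all add: f_inv_into_f)

lemma le_alg: "cls \<phi> \<sqsubseteq>\<^bsub>alg\<^esub> cls \<psi> \<longleftrightarrow> \<Gamma> \<turnstile> \<phi> \<^bold>\<rightarrow> \<psi>"
  by (simp add: alg_def) (meson inv_cls_equiv syll)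

lemma himp_alg: "cls \<phi> \<leadsto>\<^bsub>alg\<^esub> cls \<psi> = cls (\<phi> \<^bold>\<rightarrow> \<psi>)"
  by (simp add: alg_def cls_eq_iff inv_cls_equiv imp_mono)

text \<open>Used twice: for the existence of meets and, by uniqueness, for their value in
  \<open>meet_alg\<close>.\<close>

lemma greatest_and: "greatest alg (cls (\<phi> \<^bold>\<and> \<psi>)) (Lower alg {cls \<phi>, cls \<psi>})"
  unfolding greatest_def Lower_def
  by (auto simp: carrier_alg le_alg all_conj_distrib intro: and_weak and_weak_right imp_and)

lemma least_or: "least alg (cls (\<phi> \<^bold>\<or> \<psi>)) (Upper alg {cls \<phi>, cls \<psi>})"
  unfolding least_def Upper_def
  by (auto simp: carrier_alg le_alg all_conj_distrib intro: or_weak or_weak_right or_imp)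

lemma least_Bot: "least alg (cls \<^bold>\<bottom>) (carrier alg)"
  unfolding least_def by (auto simp: carrier_alg le_alg intro: ex_falso)

lemma greatest_derivable:
  assumes "\<Gamma> \<turnstile> \<phi>"
  shows "greatest alg (cls \<phi>) (carrier alg)"
  unfolding greatest_def using assms by (auto simp: carrier_alg le_alg intro: imp_weaken)

text \<open>Antisymmetry is one direction of \<open>cls_eq_iff\<close>.\<close>

sublocale partial_order alg
  by unfold_locales (auto simp: carrier_alg eq_alg le_alg cls_eq_iff intro: imp_refl syll)

sublocale bounded_lattice alg
proof
  show "\<exists>s. least alg s (Upper alg {x, y})" if "x \<in> carrier alg" "y \<in> carrier alg" for x y
    using that least_or by (auto simp: carrier_alg)
  show "\<exists>s. greatest alg s (Lower alg {x, y})" if "x \<in> carrier alg" "y \<in> carrier alg" for x y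
    using that greatest_and by (auto simp: carrier_alg)
  show "\<exists>x. least alg x (carrier alg)"
    using least_Bot by blast
  show "\<exists>x. greatest alg x (carrier alg)"
    using greatest_derivable[OF imp_refl] by blast
qed

text \<open>The library picks the infimum by \<open>SOME\<close>, so it is identified through
  uniqueness of greatest lower bounds.\<close>

lemma meet_alg: "cls \<phi> \<sqinter>\<^bsub>alg\<^esub> cls \<psi> = cls (\<phi> \<^bold>\<and> \<psi>)"
  unfolding meet_def inf_def
  using greatest_and greatest_unique by (intro some_equality) blast+

lemma join_alg: "cls \<phi> \<squnion>\<^bsub>alg\<^esub> cls \<psi> = cls (\<phi> \<^bold>\<or> \<psi>)"
  unfolding join_def sup_def
  using least_or least_unique by (intro some_equality) blast+

lemma bottom_alg: "\<bottom>\<^bsub>alg\<^esub> = cls \<^bold>\<bottom>"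
  using least_unique[OF bottom_least least_Bot] .

text \<open>The link between semantics and syntax: truth under \<open>cls\<close> is derivability
  from \<Gamma>. A formula in the class of a derivable one is derivable by
  \<open>mp\<close>.\<close>

lemma top_alg_iff: "cls \<phi> = \<top>\<^bsub>alg\<^esub> \<longleftrightarrow> \<Gamma> \<turnstile> \<phi>"
proof
  have top: "\<top>\<^bsub>alg\<^esub> = cls (\<^bold>\<bottom> \<^bold>\<rightarrow> \<^bold>\<bottom>)"
    using greatest_unique[OF top_greatest greatest_derivable[OF imp_refl]] .
  assume "cls \<phi> = \<top>\<^bsub>alg\<^esub>"
  then show "\<Gamma> \<turnstile> \<phi>"
    using mp[OF imp_refl] by (auto simp: top cls_eq_iff)
next
  assume "\<Gamma> \<turnstile> \<phi>"
  then show "cls \<phi> = \<top>\<^bsub>alg\<^esub>"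
    using greatest_unique[OF greatest_derivable top_greatest] by blast
qed

lemma alg_model_cls: "alg_model alg cls"
proof -
  have "heyting_algebra alg"
  proof
    show "a \<leadsto>\<^bsub>alg\<^esub> b \<in> carrier alg" if "a \<in> carrier alg" "b \<in> carrier alg" for a b
      using that by (auto simp: carrier_alg himp_alg)
    \<comment> \<open>On classes, residuation is the pair of rules \<open>export\<close> and
      \<open>import\<close>.\<close>
    show "a \<sqsubseteq>\<^bsub>alg\<^esub> b \<leadsto>\<^bsub>alg\<^esub> c \<longleftrightarrow> a \<sqinter>\<^bsub>alg\<^esub> b \<sqsubseteq>\<^bsub>alg\<^esub> c"
      if "a \<in> carrier alg" "b \<in> carrier alg" "c \<in> carrier alg" for a b c
      using that
      by (auto simp: carrier_alg himp_alg meet_alg le_alg intro: export derives.import)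
  qed
  then show ?thesis
    by (simp add: alg_model_def alg_interpretation_def carrier_alg bottom_alg meet_alg join_alg
        himp_alg)
qed

end

section \<open>Coding classes in an infinite type, and the equivalence\<close>

lemma ex_lindenbaum:
  assumes "infinite (UNIV :: 'h set)"
  shows "\<exists>cls :: form \<Rightarrow> 'h. lindenbaum \<Gamma> cls"
proof -
  obtain e :: "nat \<Rightarrow> 'h" where e: "inj e"
    using infinite_countable_subset[OF assms] by auto
  define R where "R \<phi> = {\<psi>. \<Gamma> \<turnstile> \<phi> \<^bold>\<rightarrow> \<psi> \<and> \<Gamma> \<turnstile> \<psi> \<^bold>\<rightarrow> \<phi>}" for \<phi>
  \<comment> \<open>The choice depends only on the set \<open>R \<phi>\<close>, so equivalent
    formulas get the same representative.\<close>
  define rep where "rep \<phi> = (SOME \<psi>. \<psi> \<in> R \<phi>)" for \<phi>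
  have rep: "rep \<phi> \<in> R \<phi>" for \<phi>
    unfolding rep_def by (rule someI[of _ \<phi>]) (simp add: R_def imp_refl)
  have "rep \<phi> = rep \<psi> \<longleftrightarrow> \<Gamma> \<turnstile> \<phi> \<^bold>\<rightarrow> \<psi> \<and> \<Gamma> \<turnstile> \<psi> \<^bold>\<rightarrow> \<phi>" for \<phi> \<psi>
  proof
    assume "rep \<phi> = rep \<psi>"
    then show "\<Gamma> \<turnstile> \<phi> \<^bold>\<rightarrow> \<psi> \<and> \<Gamma> \<turnstile> \<psi> \<^bold>\<rightarrow> \<phi>"
      using rep[of \<phi>] rep[of \<psi>] by (auto simp: R_def intro: syll)
  next
    assume "\<Gamma> \<turnstile> \<phi> \<^bold>\<rightarrow> \<psi> \<and> \<Gamma> \<turnstile> \<psi> \<^bold>\<rightarrow> \<phi>"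
    then have "R \<phi> = R \<psi>"
      by (auto simp: R_def intro: syll)
    then show "rep \<phi> = rep \<psi>" by (simp add: rep_def)
  qed
  \<comment> \<open>Both \<open>to_nat\<close> and \<open>e\<close> are injective, so coding the
    representatives keeps the kernel unchanged.\<close>
  then have "lindenbaum \<Gamma> (\<lambda>\<phi>. e (to_nat (rep \<phi>)))"
    by unfold_locales (simp add: inj_eq[OF e])
  then show ?thesis by blast
qed

theorem mainTheorem2:
  fixes \<Gamma> :: "form set" and \<phi> :: form
  assumes "infinite (UNIV :: 'h set)"
  shows "\<Gamma> \<turnstile> \<phi> \<longleftrightarrow> alg_entails TYPE('h) \<Gamma> \<phi>"
proof
  assume "\<Gamma> \<turnstile> \<phi>"
  then show "alg_entails TYPE('h) \<Gamma> \<phi>"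
    by (auto simp: alg_entails_def intro: soundness)
next
  assume entails: "alg_entails TYPE('h) \<Gamma> \<phi>"
  obtain cls :: "form \<Rightarrow> 'h" where "lindenbaum \<Gamma> cls"
    using ex_lindenbaum[OF assms] by blast
  then interpret lindenbaum \<Gamma> cls .
  \<comment> \<open>Members of \<Gamma> are derivable by \<open>hyp\<close>, so the Lindenbaum model
    is one of the models that the consequence relation ranges over.\<close>
  have "\<forall>\<psi>\<in>\<Gamma>. alg_true alg cls \<psi>"
    by (simp add: alg_true_def top_alg_iff hyp)
  with entails alg_model_cls have "alg_true alg cls \<phi>"
    unfolding alg_entails_def by blast
  then show "\<Gamma> \<turnstile> \<phi>"
    by (simp add: alg_true_def top_alg_iff)
qed

end
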